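(* Let $d_2$ be a positive integer. The neurovariety $\mathcal{V}_{(2,2,d_2),2}\subseteq(\mathrm{Sym}_2(\mathbb{R}^2))^{d_2}$ is the vanishing locus of all $3\times3$ minors of the matrix $$C_{d_2}=\begin{pmatrix}c_{11}^{(1)}&c_{12}^{(1)}&c_{22}^{(1)}\\ \vdots&\vdots&\vdots\\ c_{11}^{(d_2)}&c_{12}^{(d_2)}&c_{22}^{(d_2)}\end{pmatrix},$$ where $(c_{11}^{(j)}x_1^2+c_{12}^{(j)}x_1x_2+c_{22}^{(j)}x_2^2)_{j=1}^{d_2}$ is the element of $(\mathrm{Sym}_2(\mathbb{R}^2))^{d_2}$ with coordinates $c^{(j)}_{11},c^{(j)}_{12},c^{(j)}_{22}$.
   Context: $\mathrm{Sym}_d(\mathbb{R}^n)$ denotes the real vector space of homogeneous polynomials of degree $d$ in $n$ variables. A polynomial neural network (PNN) with architecture $(\mathbf{d}=(d_0,\dots,d_L),r)$ is the map $p_{\mathbf{w}}=W_L\circ\rho_r\circ W_{L-1}\circ\cdots\circ\rho_r\circ W_1:\mathbb{R}^{d_0}\to\mathbb{R}^{d_L}$, where $W_i\in\mathbb{R}^{d_i\times d_{i-1}}$ are linear maps (weights) $\mathbf{w}=(W_1,\dots,W_L)$ and $\rho_r$ raises each coordinate to the $r$-th power. The parameter map is $\Psi_{\mathbf{d},r}:\mathbf{w}\mapsto p_{\mathbf{w}}\in(\mathrm{Sym}_{r^{L-1}}(\mathbb{R}^{d_0}))^{d_L}$. The neuromanifold $\mathcal{M}_{\mathbf{d},r}$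 is the image of $\Psi_{\mathbf{d},r}$; the neurovariety $\mathcal{V}_{\mathbf{d},r}$ is its Zariski closure in $(\mathrm{Sym}_{r^{L-1}}(\mathbb{R}^{d_0}))^{d_L}$. With $\mathbf{d}=(2,2,d_2)$, $r=2$, the coefficient matrix of $p_{\mathbf{w}}$ is $$C_{d_2}=\begin{pmatrix}w_{211}&w_{212}\\ \vdots&\vdots\\ w_{2d_21}&w_{2d_22}\end{pmatrix}\begin{pmatrix}w_{111}^2&2w_{111}w_{112}&w_{112}^2\\ w_{121}^2&2w_{121}w_{122}&w_{122}^2\end{pmatrix},$$ where $w_{lij}$ is the $(i,j)$ entry of $W_l$. *)

theory Defs
  imports
    "HOL-Library.Poly_Mapping"
    "Jordan_Normal_Form.Determinant"
    "Jordan_Normal_Form.DL_Submatrix"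
begin

section \<open>Multivariate polynomials\<close>

text \<open>
  A monomial is its finitely supported exponent function, a polynomial is a finitely supported
  function from monomials to coefficients; multiplication is the convolution product of
  \<^theory>\<open>HOL-Library.Poly_Mapping\<close>.
\<close>

type_synonym 'v monomial = "'v \<Rightarrow>\<^sub>0 nat"
type_synonym ('v, 'a) mpoly = "'v monomial \<Rightarrow>\<^sub>0 'a"

definition mconst :: "'a::zero \<Rightarrow> ('v, 'a) mpoly" where
  "mconst c = Poly_Mapping.single 0 c"

definition mvar :: "'v \<Rightarrow> ('v, 'a::zero_neq_one) mpoly" where
  "mvar v = Poly_Mapping.single (Poly_Mapping.single v 1) 1"

definition monomial_eval :: "('v \<Rightarrow> 'a::comm_semiring_1) \<Rightarrow> 'v monomial \<Rightarrow> 'a" where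
  "monomial_eval x m = (\<Prod>v\<in>Poly_Mapping.keys m. x v ^ Poly_Mapping.lookup m v)"

definition mpoly_eval :: "('v \<Rightarrow> 'a::comm_semiring_1) \<Rightarrow> ('v, 'a) mpoly \<Rightarrow> 'a" where
  "mpoly_eval x p = (\<Sum>m\<in>Poly_Mapping.keys p. Poly_Mapping.lookup p m * monomial_eval x m)"

text \<open>\<open>Sym n d\<close> is $\mathrm{Sym}_d(\mathbb{R}^n)$; the variables are indexed by $0, \dots, n-1$.\<close>

definition Sym :: "nat \<Rightarrow> nat \<Rightarrow> (nat, real) mpoly set" where
  "Sym n d = {p. \<forall>m\<in>Poly_Mapping.keys p.
     Poly_Mapping.keys m \<subseteq> {..<n} \<and> (\<Sum>i<n. Poly_Mapping.lookup m i) = d}"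

definition Sym_tuples :: "nat \<Rightarrow> nat \<Rightarrow> nat \<Rightarrow> (nat, real) mpoly vec set" where
  "Sym_tuples n d k = {F \<in> carrier_vec k. \<forall>i<k. F $ i \<in> Sym n d}"

section \<open>Polynomial neural networks\<close>

text \<open>
  The architecture is the list $[d_0, \dots, d_L]$ and the weights are the list
  $[W_1, \dots, W_L]$.
\<close>

definition weights :: "nat list \<Rightarrow> real mat list set" where
  "weights ds = {Ws. length ds = Suc (length Ws) \<and>
     (\<forall>l<length Ws. Ws ! l \<in> carrier_mat (ds ! Suc l) (ds ! l))}"

text \<open>
  \<open>pnn r [W\<^sub>1, \<dots>, W\<^sub>L]\<close> is $W_L \circ \rho_r \circ \cdots \circ \rho_r \circ W_1$: no activation
  follows the last layer. It is defined over an arbitrary commutative semiring, so that it can be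
  applied to real vectors and to vectors of polynomials alike.
\<close>

fun pnn :: "nat \<Rightarrow> 'a::comm_semiring_1 mat list \<Rightarrow> 'a vec \<Rightarrow> 'a vec" where
  "pnn r [] x = x"
| "pnn r [W] x = W *\<^sub>v x"
| "pnn r (W # W' # Ws) x = pnn r (W' # Ws) (map_vec (\<lambda>t. t ^ r) (W *\<^sub>v x))"

text \<open>
  The parameter map: the polynomial tuple $p_{\mathbf{w}}$ is obtained by running the network on
  the variables. The lemmas \<open>mpoly_eval_param_map\<close> and \<open>param_map_in_Sym_tuples\<close> below show that it
  induces the map \<open>pnn r Ws\<close> on real vectors and is homogeneous of degree $r^{L-1}$.
\<close>

definition param_map :: "nat list \<Rightarrow> nat \<Rightarrow> real mat list \<Rightarrow> (nat, real) mpoly vec" where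
  "param_map ds r Ws = pnn r (map (map_mat mconst) Ws) (vec (hd ds) mvar)"

definition ambient :: "nat list \<Rightarrow> nat \<Rightarrow> (nat, real) mpoly vec set" where
  "ambient ds r = Sym_tuples (hd ds) (r ^ (length ds - 2)) (last ds)"

definition neuromanifold :: "nat list \<Rightarrow> nat \<Rightarrow> (nat, real) mpoly vec set" where
  "neuromanifold ds r = param_map ds r ` weights ds"

section \<open>Zariski closure\<close>

text \<open>
  The coordinates on a space of polynomial tuples: \<open>(i, m)\<close> indexes the coefficient of the monomial
  \<open>m\<close> in the \<open>i\<close>-th component. Coordinates with \<open>i\<close> out of range are set to zero.
\<close>

definition coord :: "(nat, real) mpoly vec \<Rightarrow> nat \<times> nat monomial \<Rightarrow> real" where
  "coord F = (\<lambda>(i, m). if i < dim_vec F then Poly_Mapping.lookup (F $ i) m else 0)"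

definition zariski_closed ::
  "(nat, real) mpoly vec set \<Rightarrow> (nat, real) mpoly vec set \<Rightarrow> bool" where
  "zariski_closed V X \<longleftrightarrow>
     (\<exists>Ps :: (nat \<times> nat monomial, real) mpoly set.
        X = {F \<in> V. \<forall>P\<in>Ps. mpoly_eval (coord F) P = 0})"

definition neurovariety :: "nat list \<Rightarrow> nat \<Rightarrow> (nat, real) mpoly vec set" where
  "neurovariety ds r = zariski_closed (ambient ds r) hull neuromanifold ds r"

section \<open>Minors and the coefficient matrix\<close>

definition minors :: "nat \<Rightarrow> 'a::comm_ring_1 mat \<Rightarrow> 'a set" where
  "minors k A = {det (submatrix A I J) |I J.
     I \<subseteq> {..<dim_row A} \<and> J \<subseteq> {..<dim_col A} \<and> card I = k \<and> card J = k}"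

text \<open>
  The columns are the coefficients of $x_1^2$, $x_1 x_2$, $x_2^2$; the variables $x_1, x_2$ have the
  indices \<open>0\<close> and \<open>1\<close>.
\<close>

definition binary_quadratic_monomials :: "nat monomial list" where
  "binary_quadratic_monomials =
     [Poly_Mapping.single 0 2, Poly_Mapping.single 0 1 + Poly_Mapping.single 1 1,
      Poly_Mapping.single 1 2]"

definition coeff_mat :: "(nat, real) mpoly vec \<Rightarrow> real mat" where
  "coeff_mat F = mat (dim_vec F) 3
     (\<lambda>(i, j). Poly_Mapping.lookup (F $ i) (binary_quadratic_monomials ! j))"

section \<open>The parameter map is well-defined\<close>

lemma monomial_eval_superset:
  assumes "finite A" "Poly_Mapping.keys m \<subseteq> A"
  shows "monomial_eval x m = (\<Prod>v\<in>A. x v ^ Poly_Mapping.lookup m v)"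
  unfolding monomial_eval_def using assms
  by (intro prod.mono_neutral_left) (auto simp: in_keys_iff)

lemma monomial_eval_add: "monomial_eval x (m + n) = monomial_eval x m * monomial_eval x n"
proof -
  let ?A = "Poly_Mapping.keys m \<union> Poly_Mapping.keys n"
  have "Poly_Mapping.keys (m + n) \<subseteq> ?A" by (rule keys_add)
  then have "monomial_eval x (m + n) = (\<Prod>v\<in>?A. x v ^ Poly_Mapping.lookup (m + n) v)"
    by (intro monomial_eval_superset) auto
  also have "\<dots> = (\<Prod>v\<in>?A. x v ^ Poly_Mapping.lookup m v) * (\<Prod>v\<in>?A. x v ^ Poly_Mapping.lookup n v)"
    by (simp add: lookup_add power_add prod.distrib)
  also have "\<dots> = monomial_eval x m * monomial_eval x n"
    using monomial_eval_superset[of ?A m x] monomial_eval_superset[of ?A n x] by simp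
  finally show ?thesis .
qed

lemma mpoly_eval_add: "mpoly_eval x (p + q) = mpoly_eval x p + mpoly_eval x q"
  unfolding mpoly_eval_def
  by (rule setsum_keys_plus_distrib) (auto simp: distrib_right)

lemma mpoly_eval_zero: "mpoly_eval x 0 = 0"
  by (simp add: mpoly_eval_def)

lemma mpoly_eval_sum: "mpoly_eval x (sum f A) = (\<Sum>a\<in>A. mpoly_eval x (f a))"
  by (induction A rule: infinite_finite_induct) (auto simp: mpoly_eval_add mpoly_eval_zero)

lemma mpoly_eval_single: "mpoly_eval x (Poly_Mapping.single m c) = c * monomial_eval x m"
  by (simp add: mpoly_eval_def)

lemma mpoly_as_sum:
  "p = (\<Sum>m\<in>Poly_Mapping.keys p. Poly_Mapping.single m (Poly_Mapping.lookup p m))"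
proof (rule poly_mapping_eqI)
  fix k
  show "Poly_Mapping.lookup p k = Poly_Mapping.lookup
    (\<Sum>m\<in>Poly_Mapping.keys p. Poly_Mapping.single m (Poly_Mapping.lookup p m)) k"
    by (cases "k \<in> Poly_Mapping.keys p")
      (auto simp: lookup_sum lookup_single when_def in_keys_iff sum.delta)
qed

lemma mpoly_eval_mult: "mpoly_eval x (p * q) = mpoly_eval x p * mpoly_eval x q"
proof -
  let ?s = "\<lambda>p m. Poly_Mapping.single m (Poly_Mapping.lookup p m)"
  let ?p = "\<Sum>m\<in>Poly_Mapping.keys p. ?s p m" and ?q = "\<Sum>n\<in>Poly_Mapping.keys q. ?s q n"
  have "p * q = ?p * ?q" using mpoly_as_sum[of p] mpoly_as_sum[of q] by simp
  also have "mpoly_eval x \<dots> = mpoly_eval x ?p * mpoly_eval x ?q"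
    by (simp add: sum_product mpoly_eval_sum mult_single mpoly_eval_single monomial_eval_add mult_ac)
  finally show ?thesis using mpoly_as_sum[of p] mpoly_as_sum[of q] by simp
qed

lemma mpoly_eval_mconst: "mpoly_eval x (mconst c) = c"
  by (simp add: mconst_def mpoly_eval_single monomial_eval_def)

lemma mpoly_eval_mvar: "mpoly_eval x (mvar v) = x v"
  by (simp add: mvar_def mpoly_eval_single monomial_eval_def)

lemma mpoly_eval_one: "mpoly_eval x 1 = 1"
  using mpoly_eval_mconst[of x 1] by (simp add: mconst_def)

lemma mpoly_eval_power: "mpoly_eval x (p ^ n) = mpoly_eval x p ^ n"
  by (induction n) (simp_all add: mpoly_eval_mult mpoly_eval_one)

lemma mpoly_eval_pnn:
  assumes "length ds = Suc (length Ws)" "v \<in> carrier_vec (hd ds)"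
    and "\<forall>l<length Ws. Ws ! l \<in> carrier_mat (ds ! Suc l) (ds ! l)"
  shows "map_vec (mpoly_eval x) (pnn r (map (map_mat mconst) Ws) v)
       = pnn r Ws (map_vec (mpoly_eval x) v)"
  using assms
proof (induction Ws arbitrary: ds v rule: induct_list012)
  case 1
  then show ?case by simp
next
  case (2 W)
  then obtain d0 d1 where "ds = [d0, d1]"
    by (auto simp: length_Suc_conv)
  then have "W \<in> carrier_mat d1 d0" "v \<in> carrier_vec d0" using 2 by simp_all
  then show ?case
    by (intro eq_vecI)
      (auto simp: scalar_prod_def mpoly_eval_sum mpoly_eval_mult mpoly_eval_mconst)
next
  case (3 W W' Ws)
  obtain d0 d1 ds' where ds: "ds = d0 # d1 # ds'"
    using "3.prems"(1) by (auto simp: length_Suc_conv)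
  let ?h = "mpoly_eval x" and ?W = "map_mat mconst W :: (_, _) mpoly mat"
  have W: "W \<in> carrier_mat d1 d0" using "3.prems"(3)[rule_format, of 0] ds by simp
  have v: "v \<in> carrier_vec d0" using "3.prems"(2) ds by simp
  have step: "map_vec ?h (map_vec (\<lambda>t. t ^ r) (?W *\<^sub>v v))
      = map_vec (\<lambda>t. t ^ r) (W *\<^sub>v map_vec ?h v)"
    using W v
    by (intro eq_vecI)
      (auto simp: scalar_prod_def mpoly_eval_sum mpoly_eval_mult mpoly_eval_mconst mpoly_eval_power)
  have "map_vec ?h (pnn r (map (map_mat mconst) (W' # Ws)) (map_vec (\<lambda>t. t ^ r) (?W *\<^sub>v v)))
      = pnn r (W' # Ws) (map_vec ?h (map_vec (\<lambda>t. t ^ r) (?W *\<^sub>v v)))"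
  proof (rule "3.IH"(2))
    show "length (d1 # ds') = Suc (length (W' # Ws))" using "3.prems"(1) ds by simp
    show "map_vec (\<lambda>t. t ^ r) (?W *\<^sub>v v) \<in> carrier_vec (hd (d1 # ds'))"
      using W by (intro carrier_vecI) simp
    show "\<forall>l<length (W' # Ws). (W' # Ws) ! l \<in> carrier_mat ((d1 # ds') ! Suc l) ((d1 # ds') ! l)"
      using "3.prems"(3)[rule_format, of "Suc _"] ds by simp
  qed
  then show ?case using step by simp
qed

lemma mpoly_eval_param_map:
  assumes "Ws \<in> weights ds"
  shows "map_vec (mpoly_eval x) (param_map ds r Ws) = pnn r Ws (vec (hd ds) x)"
proof -
  have "map_vec (mpoly_eval x) (vec (hd ds) mvar) = vec (hd ds) x"
    by (intro eq_vecI) (auto simp: mpoly_eval_mvar)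
  then show ?thesis
    using assms mpoly_eval_pnn[of ds Ws "vec (hd ds) mvar" x r]
    by (simp add: param_map_def weights_def)
qed

lemma Sym_zero: "0 \<in> Sym n d"
  by (simp add: Sym_def)

lemma Sym_add: "p \<in> Sym n d \<Longrightarrow> q \<in> Sym n d \<Longrightarrow> p + q \<in> Sym n d"
  using keys_add[of p q] by (auto simp: Sym_def)

lemma Sym_sum: "(\<And>a. a \<in> A \<Longrightarrow> f a \<in> Sym n d) \<Longrightarrow> sum f A \<in> Sym n d"
  by (induction A rule: infinite_finite_induct) (auto intro: Sym_add Sym_zero)

lemma Sym_mult:
  assumes "p \<in> Sym n d" "q \<in> Sym n e"
  shows "p * q \<in> Sym n (d + e)"
  unfolding Sym_def
proof (clarify, intro conjI)
  fix m assume "m \<in> Poly_Mapping.keys (p * q)"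
  then obtain a b where m: "m = a + b" and "a \<in> Poly_Mapping.keys p" "b \<in> Poly_Mapping.keys q"
    using keys_mult[of p q] by blast
  then have ab: "Poly_Mapping.keys a \<subseteq> {..<n}" "(\<Sum>i<n. Poly_Mapping.lookup a i) = d"
    "Poly_Mapping.keys b \<subseteq> {..<n}" "(\<Sum>i<n. Poly_Mapping.lookup b i) = e"
    using assms by (auto simp: Sym_def)
  show "Poly_Mapping.keys m \<subseteq> {..<n}" using keys_add[of a b] ab m by blast
  show "(\<Sum>i<n. Poly_Mapping.lookup m i) = d + e" using ab m by (simp add: lookup_add sum.distrib)
qed

lemma Sym_mconst: "mconst c \<in> Sym n 0"
  by (auto simp: Sym_def mconst_def split: if_splits)

lemma Sym_mvar: "i < n \<Longrightarrow> mvar i \<in> Sym n 1"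
  by (auto simp: Sym_def mvar_def lookup_single when_def)

lemma Sym_power: "p \<in> Sym n d \<Longrightarrow> p ^ k \<in> Sym n (d * k)"
proof (induction k)
  case 0
  then show ?case using Sym_mconst[of 1 n] by (simp add: mconst_def)
next
  case (Suc k)
  then show ?case using Sym_mult[of p n d "p ^ k" "d * k"] by simp
qed

lemma Sym_tuples_mult_mat_vec:
  assumes "W \<in> carrier_mat b a" "v \<in> Sym_tuples n d a"
  shows "map_mat mconst W *\<^sub>v v \<in> Sym_tuples n d b"
proof -
  have "mconst c * v $ j \<in> Sym n d" if "j < a" for c j
    using Sym_mult[OF Sym_mconst[of c n], of "v $ j" d] that assms(2) by (simp add: Sym_tuples_def)
  then show ?thesis
    using assms by (auto simp: Sym_tuples_def scalar_prod_def intro!: Sym_sum)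
qed

lemma pnn_in_Sym_tuples:
  assumes "length ds = Suc (length Ws)" "Ws \<noteq> []" "v \<in> Sym_tuples n d (hd ds)"
    and "\<forall>l<length Ws. Ws ! l \<in> carrier_mat (ds ! Suc l) (ds ! l)"
  shows "pnn r (map (map_mat mconst) Ws) v \<in> Sym_tuples n (d * r ^ (length Ws - 1)) (last ds)"
  using assms
proof (induction Ws arbitrary: ds d v rule: induct_list012)
  case 1
  then show ?case by simp
next
  case (2 W)
  then obtain d0 d1 where ds: "ds = [d0, d1]"
    by (auto simp: length_Suc_conv)
  then show ?case using 2 by (simp add: Sym_tuples_mult_mat_vec)
next
  case (3 W W' Ws)
  obtain d0 d1 ds' where ds: "ds = d0 # d1 # ds'"
    using "3.prems"(1) by (auto simp: length_Suc_conv)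
  let ?v = "map_vec (\<lambda>t. t ^ r) (map_mat mconst W *\<^sub>v v)"
  have W: "W \<in> carrier_mat d1 d0" using "3.prems"(4)[rule_format, of 0] ds by simp
  have "map_mat mconst W *\<^sub>v v \<in> Sym_tuples n d d1"
    using W "3.prems"(3) ds by (intro Sym_tuples_mult_mat_vec) auto
  then have v: "?v \<in> Sym_tuples n (d * r) d1"
    using W by (simp add: Sym_tuples_def Sym_power del: index_mult_mat_vec)
  have "pnn r (map (map_mat mconst) (W' # Ws)) ?v
      \<in> Sym_tuples n (d * r * r ^ (length (W' # Ws) - 1)) (last (d1 # ds'))"
  proof (rule "3.IH"(2))
    show "length (d1 # ds') = Suc (length (W' # Ws))" using "3.prems"(1) ds by simp
    show "?v \<in> Sym_tuples n (d * r) (hd (d1 # ds'))" using v by simp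
    show "\<forall>l<length (W' # Ws). (W' # Ws) ! l \<in> carrier_mat ((d1 # ds') ! Suc l) ((d1 # ds') ! l)"
      using "3.prems"(4)[rule_format, of "Suc _"] ds by simp
  qed simp
  then show ?case using ds by (simp add: mult.assoc)
qed

lemma param_map_in_Sym_tuples:
  assumes "Ws \<in> weights ds" "length ds \<ge> 2"
  shows "param_map ds r Ws \<in> Sym_tuples (hd ds) (r ^ (length ds - 2)) (last ds)"
proof -
  have "vec (hd ds) mvar \<in> Sym_tuples (hd ds) 1 (hd ds)"
    using Sym_mvar by (auto simp: Sym_tuples_def)
  moreover have "Ws \<noteq> []" using assms by (auto simp: weights_def)
  ultimately show ?thesis
    using assms pnn_in_Sym_tuples[of ds Ws "vec (hd ds) mvar" "hd ds" 1 r]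
    by (simp add: param_map_def weights_def numeral_2_eq_2)
qed

end

theory Submission
  imports Defs
begin

text \<open>
  The minors of a coefficient matrix vanish iff some \<open>n \<noteq> 0\<close> is orthogonal to all its rows. If the
  quadratic form with coefficients \<open>n\<^sub>1, 2 n\<^sub>2, n\<^sub>3\<close> is indefinite, its two real zeros give two squares
  of linear forms spanning the orthogonal complement of \<open>n\<close>, so the tuple is in the neuromanifold.
  In general, the rows move along lines \<open>w\<^sub>i + t d\<^sub>i\<close> orthogonal to \<open>n + t (1, 0, -1)\<close>, which is
  indefinite for all large \<open>t\<close>. A polynomial vanishing on the neuromanifold restricts to a polynomial
  in \<open>t\<close> with infinitely many zeros, so it also vanishes at \<open>t = 0\<close>.
\<close>

section \<open>Binary quadratic forms\<close>

text \<open>The arguments are ordered like the columns of \<open>coeff_mat\<close>.\<close>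

definition quadratic_form :: "real \<Rightarrow> real \<Rightarrow> real \<Rightarrow> (nat, real) mpoly" where
  "quadratic_form x y z =
     Poly_Mapping.single (Poly_Mapping.single 0 2) x
     + Poly_Mapping.single (Poly_Mapping.single 0 1 + Poly_Mapping.single 1 1) y
     + Poly_Mapping.single (Poly_Mapping.single 1 2) z"

text \<open>The exponents of the variable \<open>0\<close> are 2, 1 and 0, which separates the three
  monomials.\<close>

lemma binary_quadratic_monomials_distinct:
  "(Poly_Mapping.single 0 2 :: nat monomial) \<noteq> Poly_Mapping.single 0 1 + Poly_Mapping.single 1 1"
  "(Poly_Mapping.single 0 2 :: nat monomial) \<noteq> Poly_Mapping.single 1 2"
  "(Poly_Mapping.single 1 2 :: nat monomial) \<noteq> Poly_Mapping.single 0 1 + Poly_Mapping.single 1 1"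
  by (auto dest!: arg_cong[where f = "\<lambda>m. Poly_Mapping.lookup m 0"]
      simp: lookup_add lookup_single simp del: single_numeral single_one)

lemma lookup_quadratic_form:
  "Poly_Mapping.lookup (quadratic_form x y z) m =
     (if m = Poly_Mapping.single 0 2 then x
      else if m = Poly_Mapping.single 0 1 + Poly_Mapping.single 1 1 then y
      else if m = Poly_Mapping.single 1 2 then z else 0)"
  using binary_quadratic_monomials_distinct
  by (auto simp: quadratic_form_def lookup_add lookup_single when_def)

lemma lookup_quadratic_form_monomials:
  "Poly_Mapping.lookup (quadratic_form x y z) (binary_quadratic_monomials ! 0) = x"
  "Poly_Mapping.lookup (quadratic_form x y z) (binary_quadratic_monomials ! 1) = y"
  "Poly_Mapping.lookup (quadratic_form x y z) (binary_quadratic_monomials ! 2) = z"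
  unfolding lookup_quadratic_form binary_quadratic_monomials_def
  using binary_quadratic_monomials_distinct
  by (simp_all del: single_numeral single_one)

text \<open>Two natural exponents with sum 2 can only be (2, 0), (1, 1) or (0, 2).\<close>

lemma Sym_2_2_eq_quadratic_form:
  assumes "p \<in> Sym 2 2"
  shows "p = quadratic_form (Poly_Mapping.lookup p (binary_quadratic_monomials ! 0))
    (Poly_Mapping.lookup p (binary_quadratic_monomials ! 1))
    (Poly_Mapping.lookup p (binary_quadratic_monomials ! 2))"
proof (rule poly_mapping_eqI)
  fix m
  have "m \<in> {Poly_Mapping.single 0 2, Poly_Mapping.single 0 1 + Poly_Mapping.single 1 1,
      Poly_Mapping.single 1 2}" if "m \<in> Poly_Mapping.keys p"
  proof -
    have keys: "Poly_Mapping.keys m \<subseteq> {..<2}"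
      and "(\<Sum>i<2. Poly_Mapping.lookup m i) = 2"
      using assms that by (auto simp: Sym_def)
    then have "Poly_Mapping.lookup m 0 + Poly_Mapping.lookup m 1 = 2"
      by (simp add: lessThan_nat_numeral lessThan_Suc)
    then have cases: "Poly_Mapping.lookup m 0 = 2 \<and> Poly_Mapping.lookup m 1 = 0
      \<or> Poly_Mapping.lookup m 0 = 1 \<and> Poly_Mapping.lookup m 1 = 1
      \<or> Poly_Mapping.lookup m 0 = 0 \<and> Poly_Mapping.lookup m 1 = 2"
      by linarith
    have eqI: "m = m'"
      if "Poly_Mapping.lookup m' 0 = Poly_Mapping.lookup m 0"
        "Poly_Mapping.lookup m' 1 = Poly_Mapping.lookup m 1"
        "\<And>i. i > 1 \<Longrightarrow> Poly_Mapping.lookup m' i = 0" for m'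
    proof (rule poly_mapping_eqI)
      fix i :: nat
      have "Poly_Mapping.lookup m i = 0" if "i > 1"
        using keys that by (auto simp: in_keys_iff subset_iff)
      then show "Poly_Mapping.lookup m i = Poly_Mapping.lookup m' i"
        using that by (cases "i = 0"; cases "i = 1") auto
    qed
    \<comment> \<open>\<open>single_numeral\<close> and \<open>single_one\<close> would turn the monomial \<open>single 0 n\<close> into the numeral \<open>n\<close>.\<close>
    from cases show ?thesis
    proof (elim disjE)
      assume "Poly_Mapping.lookup m 0 = 2 \<and> Poly_Mapping.lookup m 1 = 0"
      then have "m = Poly_Mapping.single 0 2"
        by (intro eqI)
          (simp_all add: lookup_single lookup_add when_def del: single_numeral single_one)
      then show ?thesis by blast
    next
      assume "Poly_Mapping.lookup m 0 = 1 \<and> Poly_Mapping.lookup m 1 = 1"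
      then have "m = Poly_Mapping.single 0 1 + Poly_Mapping.single 1 1"
        by (intro eqI)
          (simp_all add: lookup_single lookup_add when_def del: single_numeral single_one)
      then show ?thesis by blast
    next
      assume "Poly_Mapping.lookup m 0 = 0 \<and> Poly_Mapping.lookup m 1 = 2"
      then have "m = Poly_Mapping.single 1 2"
        by (intro eqI)
          (simp_all add: lookup_single lookup_add when_def del: single_numeral single_one)
      then show ?thesis by blast
    qed
  qed
  then show "Poly_Mapping.lookup p m = Poly_Mapping.lookup
    (quadratic_form (Poly_Mapping.lookup p (binary_quadratic_monomials ! 0))
      (Poly_Mapping.lookup p (binary_quadratic_monomials ! 1))
      (Poly_Mapping.lookup p (binary_quadratic_monomials ! 2))) m"
    by (auto simp: lookup_quadratic_form binary_quadratic_monomials_def in_keys_iff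
        simp del: One_nat_def)
qed

text \<open>This is the contribution of one hidden neuron with incoming weights \<open>a\<close>,
  \<open>b\<close> and outgoing weight \<open>k\<close>.\<close>

lemma mconst_times_square_of_linear_form:
  "mconst k * (mconst a * mvar 0 + mconst b * mvar 1)\<^sup>2 =
     quadratic_form (k * a\<^sup>2) (2 * k * a * b) (k * b\<^sup>2)"
proof -
  let ?X = "mvar 0 :: (nat, real) mpoly" and ?Y = "mvar 1 :: (nat, real) mpoly"
  have sq: "mconst k * (mconst a * ?X + mconst b * ?Y)\<^sup>2 =
      (mconst k * mconst a * mconst a) * (?X * ?X)
      + (mconst k * mconst a * mconst b + mconst k * mconst a * mconst b) * (?X * ?Y)
      + (mconst k * mconst b * mconst b) * (?Y * ?Y)"
    by (simp add: power2_eq_square algebra_simps)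
  have conv: "mconst x * mconst y * mconst z = mconst (x * y * z)" for x y z :: real
    by (simp add: mconst_def mult_single)
  have dbl: "mconst x + mconst x = mconst (2 * x)" for x :: real
    by (simp add: mconst_def flip: single_add)
  have mon: "mconst x * (?X * ?X) = Poly_Mapping.single (Poly_Mapping.single 0 2) x"
    "mconst x * (?Y * ?Y) = Poly_Mapping.single (Poly_Mapping.single 1 2) x"
    "mconst x * (?X * ?Y)
      = Poly_Mapping.single (Poly_Mapping.single 0 1 + Poly_Mapping.single 1 1) x" for x
    by (simp_all add: mconst_def mvar_def mult_single numeral_2_eq_2
        del: single_numeral single_one flip: single_add)
  show ?thesis
    unfolding sq conv dbl mon quadratic_form_def
    by (simp add: power2_eq_square mult_ac del: single_numeral single_one)
qed

lemma quadratic_form_add: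
  "quadratic_form x y z + quadratic_form x' y' z' = quadratic_form (x + x') (y + y') (z + z')"
  by (simp only: quadratic_form_def single_add add_ac)

lemma param_map_2_2:
  assumes "W\<^sub>1 \<in> carrier_mat 2 2" "W\<^sub>2 \<in> carrier_mat d 2"
  shows "param_map [2, 2, d] 2 [W\<^sub>1, W\<^sub>2] = vec d (\<lambda>i. quadratic_form
    (W\<^sub>2 $$ (i, 0) * (W\<^sub>1 $$ (0, 0))\<^sup>2 + W\<^sub>2 $$ (i, 1) * (W\<^sub>1 $$ (1, 0))\<^sup>2)
    (2 * W\<^sub>2 $$ (i, 0) * W\<^sub>1 $$ (0, 0) * W\<^sub>1 $$ (0, 1)
      + 2 * W\<^sub>2 $$ (i, 1) * W\<^sub>1 $$ (1, 0) * W\<^sub>1 $$ (1, 1))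
    (W\<^sub>2 $$ (i, 0) * (W\<^sub>1 $$ (0, 1))\<^sup>2 + W\<^sub>2 $$ (i, 1) * (W\<^sub>1 $$ (1, 1))\<^sup>2))"
proof -
  have [simp]: "(\<Sum>j = 0..<2. f j) = f 0 + f 1" for f :: "nat \<Rightarrow> 'b::comm_monoid_add"
    by (simp add: numeral_2_eq_2)
  \<comment> \<open>The reversed rewriting splits each target form into the weighted squares of the
    two hidden neurons.\<close>
  show ?thesis
    using assms
    by (intro eq_vecI)
      (auto simp: param_map_def scalar_prod_def
        simp flip: quadratic_form_add mconst_times_square_of_linear_form)
qed

section \<open>Matrices with three columns\<close>

text \<open>The determinant of the rows \<open>i\<close>, \<open>j\<close>, \<open>k\<close>,
  expanded along row \<open>i\<close>. Allowing any commutative ring covers real matrices as well as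
  matrices of polynomials.\<close>

definition row_det3 :: "'a::comm_ring_1 mat \<Rightarrow> nat \<Rightarrow> nat \<Rightarrow> nat \<Rightarrow> 'a" where
  "row_det3 A i j k =
     A $$ (i, 0) * (A $$ (j, 1) * A $$ (k, 2) - A $$ (j, 2) * A $$ (k, 1))
     - A $$ (i, 1) * (A $$ (j, 0) * A $$ (k, 2) - A $$ (j, 2) * A $$ (k, 0))
     + A $$ (i, 2) * (A $$ (j, 0) * A $$ (k, 1) - A $$ (j, 1) * A $$ (k, 0))"

lemma det_3:
  assumes "A \<in> carrier_mat 3 3"
  shows "det A = row_det3 A 0 1 2"
proof -
  have det_2: "det B = B $$ (0, 0) * B $$ (1, 1) - B $$ (0, 1) * B $$ (1, 0)"
    if "B \<in> carrier_mat 2 2" for B :: "'a mat"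
    using that
    by (subst laplace_expansion_row[of _ 2 0])
      (auto simp: lessThan_nat_numeral lessThan_Suc cofactor_def mat_delete_def det_single)
  show ?thesis
    using assms
    by (subst laplace_expansion_row[of _ 3 0])
      (auto simp: lessThan_nat_numeral lessThan_Suc cofactor_def mat_delete_def det_2 row_det3_def
        numeral_2_eq_2 algebra_simps)
qed

lemma row_det3_swap:
  "row_det3 A j i k = - row_det3 A i j k" "row_det3 A i k j = - row_det3 A i j k"
  by (simp_all add: row_det3_def algebra_simps)

lemma row_det3_repeated: "row_det3 A i i k = 0" "row_det3 A i k k = 0" "row_det3 A i k i = 0"
  by (simp_all add: row_det3_def algebra_simps)

text \<open>The determinant is alternating: repeated rows give 0, and at most three adjacent swaps,
  each changing only the sign, sort distinct indices.\<close>

lemma row_det3_eq_0_if_increasing: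
  assumes "\<And>i j k. i < j \<Longrightarrow> j < k \<Longrightarrow> k < n \<Longrightarrow> row_det3 A i j k = 0" "i < n" "j < n" "k < n"
  shows "row_det3 A i j k = 0"
proof -
  have swap: "row_det3 A j i k = 0 \<Longrightarrow> row_det3 A i j k = 0"
    "row_det3 A i k j = 0 \<Longrightarrow> row_det3 A i j k = 0" for i j k
    using row_det3_swap[of A i j k] by simp_all
  consider "i = j \<or> j = k \<or> i = k" | "i < j" "j < k" | "i < k" "k < j" | "j < i" "i < k"
    | "j < k" "k < i" | "k < i" "i < j" | "k < j" "j < i"
    by linarith
  then show ?thesis
  proof cases
    case 1
    then show ?thesis by (auto simp: row_det3_repeated)
  next
    case 2
    then show ?thesis using assms by blast
  next
    case 3
    then show ?thesis using assms by (intro swap(2)[OF assms(1)])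
  next
    case 4
    then show ?thesis using assms by (intro swap(1)[OF assms(1)])
  next
    case 5
    then show ?thesis using assms by (intro swap(1)[OF swap(2)[OF assms(1)]])
  next
    case 6
    then show ?thesis using assms by (intro swap(2)[OF swap(1)[OF assms(1)]])
  next
    case 7
    then show ?thesis using assms by (intro swap(1)[OF swap(2)[OF swap(1)[OF assms(1)]]])
  qed
qed

lemma det_submatrix_3:
  assumes "A \<in> carrier_mat n 3" "I \<subseteq> {..<n}" "card I = 3"
  shows "det (submatrix A I {..<3}) = row_det3 A (pick I 0) (pick I 1) (pick I 2)"
proof -
  have "{i. i < dim_row A \<and> i \<in> I} = I" "{j. j < dim_col A \<and> j \<in> {..<3}} = {..<3}"
    using assms by auto
  then have I: "card {i. i < dim_row A \<and> i \<in> I} = 3"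
    and J: "card {j. j < dim_col A \<and> j \<in> {..<3}} = 3"
    using assms(3) by simp_all
  \<comment> \<open>Below 3, picking from \<open>{..<3}\<close> agrees with picking from all
    naturals, which is the identity.\<close>
  have pick: "pick {..<3} j = j" if "j < 3" for j
    using pick_reduce_set[of j 3 UNIV] that by (simp add: pick_UNIV lessThan_def)
  have "submatrix A I {..<3} \<in> carrier_mat 3 3"
    using I J by (intro carrier_matI) (simp_all only: dim_submatrix)
  moreover have "submatrix A I {..<3} $$ (i, j) = A $$ (pick I i, j)" if "i < 3" "j < 3" for i j
  proof -
    have "i < card {i. i < dim_row A \<and> i \<in> I}" "j < card {j. j < dim_col A \<and> j \<in> {..<3}}"
      unfolding I J by fact+
    then show ?thesis using submatrix_index[of i A I j "{..<3}"] pick[OF that(2)] by metis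
  qed
  ultimately show ?thesis
    by (simp add: det_3 row_det3_def del: pick.simps One_nat_def)
qed

text \<open>The position of an element in the enumeration is the number of smaller elements of the
  set.\<close>

lemma pick_triple:
  assumes "i < j" "j < k"
  shows "pick {i, j, k} 0 = i" "pick {i, j, k} 1 = j" "pick {i, j, k} 2 = k"
proof -
  have "{a \<in> {i, j, k}. a < i} = {}" "{a \<in> {i, j, k}. a < j} = {i}" "{a \<in> {i, j, k}. a < k} = {i, j}"
    using assms by auto
  then have card: "card {a \<in> {i, j, k}. a < i} = 0" "card {a \<in> {i, j, k}. a < j} = 1"
    "card {a \<in> {i, j, k}. a < k} = 2"
    using assms by simp_all
  then show "pick {i, j, k} 0 = i" "pick {i, j, k} 1 = j" "pick {i, j, k} 2 = k"
    using pick_card_in_set[of i "{i, j, k}"] pick_card_in_set[of j "{i, j, k}"]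
      pick_card_in_set[of k "{i, j, k}"]
    unfolding card by blast+
qed

text \<open>Row sets of size 3 correspond to increasing triples; the remaining triples come for free
  because the determinant alternates. With three columns, the only column set is the full
  one.\<close>

lemma minors_3_vanish_iff:
  assumes "A \<in> carrier_mat n 3"
  shows "(\<forall>\<mu>\<in>minors 3 A. \<mu> = 0) \<longleftrightarrow> (\<forall>i<n. \<forall>j<n. \<forall>k<n. row_det3 A i j k = 0)"
proof
  assume minors: "\<forall>\<mu>\<in>minors 3 A. \<mu> = 0"
  have "row_det3 A i j k = 0" if "i < j" "j < k" "k < n" for i j k
  proof -
    have I: "{i, j, k} \<subseteq> {..<n}" "card {i, j, k} = 3" using that by auto
    then have "det (submatrix A {i, j, k} {..<3}) \<in> minors 3 A"
      unfolding minors_def using assms by fastforce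
    then show ?thesis
      using minors det_submatrix_3[OF assms I] pick_triple[OF that(1,2)] by simp
  qed
  then show "\<forall>i<n. \<forall>j<n. \<forall>k<n. row_det3 A i j k = 0"
    using row_det3_eq_0_if_increasing by blast
next
  assume rows: "\<forall>i<n. \<forall>j<n. \<forall>k<n. row_det3 A i j k = 0"
  show "\<forall>\<mu>\<in>minors 3 A. \<mu> = 0"
  proof
    fix \<mu> assume "\<mu> \<in> minors 3 A"
    then obtain I J where IJ: "\<mu> = det (submatrix A I J)" "I \<subseteq> {..<n}" "card I = 3"
      "J \<subseteq> {..<3}" "card J = 3"
      using assms unfolding minors_def by auto
    have "J = {..<3}" using IJ by (intro card_subset_eq) auto
    moreover have "pick I l < n" if "l < 3" for l
      using pick_in_set_le[of l I] IJ that by auto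
    ultimately show "\<mu> = 0"
      using IJ det_submatrix_3[OF assms, of I] rows by (simp del: pick.simps)
  qed
qed

text \<open>Rows are regarded as vectors in 3-space. A nonzero cross product of two rows is
  orthogonal to every row, since all triple products vanish. If all cross products vanish, the rows
  are parallel, and a vector orthogonal to one nonzero row suffices.\<close>

lemma kernel_vector3:
  fixes x y z :: "nat \<Rightarrow> 'a::idom"
  assumes "\<And>i j k. i < n \<Longrightarrow> j < n \<Longrightarrow> k < n \<Longrightarrow>
    x i * (y j * z k - z j * y k) - y i * (x j * z k - z j * x k) + z i * (x j * y k - y j * x k) = 0"
  shows "\<exists>a b c. (a, b, c) \<noteq> (0, 0, 0) \<and> (\<forall>i<n. a * x i + b * y i + c * z i = 0)"
proof (cases "\<exists>j<n. \<exists>k<n. (y j * z k - z j * y k, z j * x k - x j * z k, x j * y k - y j * x k) \<noteq> (0, 0, 0)")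
  case True
  then obtain j k where jk: "j < n" "k < n"
    "(y j * z k - z j * y k, z j * x k - x j * z k, x j * y k - y j * x k) \<noteq> (0, 0, 0)" by blast
  have "(y j * z k - z j * y k) * x i + (z j * x k - x j * z k) * y i + (x j * y k - y j * x k) * z i = 0"
    if "i < n" for i
    using assms[OF that jk(1,2)] by (simp add: algebra_simps)
  then show ?thesis using jk(3) by blast
next
  case False
  then have cross: "y j * z k = z j * y k" "z j * x k = x j * z k" "x j * y k = y j * x k"
    if "j < n" "k < n" for j k using that by auto
  show ?thesis
  proof (cases "\<exists>j<n. (x j, y j, z j) \<noteq> (0, 0, 0)")
    case True
    then obtain j where j: "j < n" "(x j, y j, z j) \<noteq> (0, 0, 0)" by blast
    \<comment> \<open>Two candidates orthogonal to row \<open>j\<close>, and by \<open>cross\<close>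
      to all rows. They cannot both be zero, since row \<open>j\<close> is not.\<close>
    have 1: "- y j * x i + x j * y i + 0 * z i = 0" "0 * x i + - z j * y i + y j * z i = 0"
      if "i < n" for i
      using cross[OF j(1) that] by simp_all
    show ?thesis
    proof (cases "(- y j, x j) = (0, 0)")
      case True
      then have "(0, - z j, y j) \<noteq> (0, 0, 0)" using j by auto
      then show ?thesis using 1(2) by blast
    next
      case False
      then have "(- y j, x j, 0) \<noteq> (0, 0, 0)" by auto
      then show ?thesis using 1(1) by blast
    qed
  next
    case False
    then have "1 * x i + 0 * y i + 0 * z i = 0" if "i < n" for i using that by auto
    moreover have "(1, 0, 0) \<noteq> (0::'a, 0::'a, 0::'a)" by simp
    ultimately show ?thesis by blast
  qed
qed

section \<open>The closed set cut out by the minors\<close>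

lemma coeff_mat_carrier: "F \<in> carrier_vec d \<Longrightarrow> coeff_mat F \<in> carrier_mat d 3"
  by (auto simp: coeff_mat_def)

lemma mpoly_eval_diff:
  fixes p q :: "('v, 'a::comm_ring_1) mpoly"
  shows "mpoly_eval x (p - q) = mpoly_eval x p - mpoly_eval x q"
  using mpoly_eval_add[of x "p - q" q] by simp

text \<open>The equations are the determinants of the generic matrix \<open>M\<close> of coordinate
  variables. Evaluation respects the ring operations, so at \<open>coord F\<close> they become those
  of \<open>coeff_mat F\<close>.\<close>

lemma zariski_closed_row_det3:
  "zariski_closed (Sym_tuples 2 2 d)
    {F \<in> Sym_tuples 2 2 d. \<forall>i<d. \<forall>j<d. \<forall>k<d. row_det3 (coeff_mat F) i j k = 0}"
proof -
  define M :: "(nat \<times> nat monomial, real) mpoly mat"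
    where "M = mat d 3 (\<lambda>(i, j). mvar (i, binary_quadratic_monomials ! j))"
  define Ps where "Ps = {row_det3 M i j k | i j k. i < d \<and> j < d \<and> k < d}"
  have eval: "mpoly_eval (coord F) (row_det3 M i j k) = row_det3 (coeff_mat F) i j k"
    if "F \<in> Sym_tuples 2 2 d" "i < d" "j < d" "k < d" for F i j k
  proof -
    have "dim_vec F = d" using that(1) by (auto simp: Sym_tuples_def)
    then show ?thesis
      using that(2-)
      by (simp add: row_det3_def M_def coeff_mat_def mpoly_eval_add mpoly_eval_diff
          mpoly_eval_mult mpoly_eval_mvar coord_def)
  qed
  have "(\<forall>P\<in>Ps. mpoly_eval x P = 0)
      \<longleftrightarrow> (\<forall>i<d. \<forall>j<d. \<forall>k<d. mpoly_eval x (row_det3 M i j k) = 0)" for x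
    unfolding Ps_def by blast
  then have "{F \<in> Sym_tuples 2 2 d. \<forall>i<d. \<forall>j<d. \<forall>k<d. row_det3 (coeff_mat F) i j k = 0}
      = {F \<in> Sym_tuples 2 2 d. \<forall>P\<in>Ps. mpoly_eval (coord F) P = 0}"
    using eval by (intro Collect_cong conj_cong) simp_all
  then show ?thesis unfolding zariski_closed_def by blast
qed

text \<open>With two hidden neurons, every row is a combination of the same two vectors, so any
  three rows are dependent.\<close>

lemma neuromanifold_row_det3:
  assumes "F \<in> neuromanifold [2, 2, d] 2" "i < d" "j < d" "k < d"
  shows "row_det3 (coeff_mat F) i j k = 0"
proof -
  obtain Ws where Ws: "F = param_map [2, 2, d] 2 Ws" "length Ws = 2"
    "\<forall>l<length Ws. Ws ! l \<in> carrier_mat ([2, 2, d] ! Suc l) ([2, 2, d] ! l)"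
    using assms(1) unfolding neuromanifold_def weights_def by auto
  then obtain W\<^sub>1 W\<^sub>2 where "Ws = [W\<^sub>1, W\<^sub>2]" by (auto simp: length_Suc_conv numeral_2_eq_2)
  moreover from this have "W\<^sub>1 \<in> carrier_mat 2 2" "W\<^sub>2 \<in> carrier_mat d 2"
    using Ws(3)[rule_format, of 0] Ws(3)[rule_format, of 1] by simp_all
  ultimately show ?thesis
    using assms(2-) Ws(1)
    by (simp add: param_map_2_2 row_det3_def coeff_mat_def lookup_quadratic_form_monomials
        power2_eq_square algebra_simps del: One_nat_def)
qed

section \<open>Density of the neuromanifold\<close>

text \<open>The sign conditions make \<open>a r\<^sup>2 + 2 b r + c\<close> have distinct real roots \<open>\<rho>\<close> and \<open>\<sigma>\<close>, so the
  forms orthogonal to \<open>(a, b, c)\<close> are spanned by the squares of \<open>\<rho> x\<^sub>1 + x\<^sub>2\<close> and \<open>\<sigma> x\<^sub>1 + x\<^sub>2\<close>.\<close>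

lemma orthogonal_to_indefinite_in_neuromanifold:
  fixes a b c :: real
  assumes "a > 0" "c < 0" and orth: "\<And>i. i < d \<Longrightarrow> a * x i + b * y i + c * z i = 0"
  shows "vec d (\<lambda>i. quadratic_form (x i) (y i) (z i)) \<in> neuromanifold [2, 2, d] 2"
proof -
  \<comment> \<open>A quarter of the discriminant of \<open>a r\<^sup>2 + 2 b r + c\<close> is under
    the root; it is positive because \<open>a * c < 0\<close>.\<close>
  define D where "D = sqrt (b\<^sup>2 - a * c)"
  have "a * c < 0" using assms by (simp add: mult_pos_neg)
  then have "b\<^sup>2 - a * c > 0" using zero_le_power2[of b] by linarith
  then have D: "D > 0" "D\<^sup>2 = b\<^sup>2 - a * c" by (simp_all add: D_def)
  define \<rho> \<sigma> where "\<rho> = (- b + D) / a" and "\<sigma> = (- b - D) / a"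
  have roots: "a * \<rho>\<^sup>2 + 2 * b * \<rho> + c = 0" "a * \<sigma>\<^sup>2 + 2 * b * \<sigma> + c = 0"
  proof -
    have \<rho>: "a * \<rho> = - b + D" and \<sigma>: "a * \<sigma> = - b - D" using assms by (simp_all add: \<rho>_def \<sigma>_def)
    have "a * (a * \<rho>\<^sup>2 + 2 * b * \<rho> + c) = (a * \<rho>)\<^sup>2 + 2 * b * (a * \<rho>) + a * c"
      "a * (a * \<sigma>\<^sup>2 + 2 * b * \<sigma> + c) = (a * \<sigma>)\<^sup>2 + 2 * b * (a * \<sigma>) + a * c"
      by (simp_all add: power2_eq_square algebra_simps)
    then have "a * (a * \<rho>\<^sup>2 + 2 * b * \<rho> + c) = 0" "a * (a * \<sigma>\<^sup>2 + 2 * b * \<sigma> + c) = 0"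
      unfolding \<rho> \<sigma> using D(2) by (simp_all add: power2_eq_square algebra_simps)
    then show "a * \<rho>\<^sup>2 + 2 * b * \<rho> + c = 0" "a * \<sigma>\<^sup>2 + 2 * b * \<sigma> + c = 0" using assms by simp_all
  qed
  have "\<rho> - \<sigma> = 2 * D / a" by (simp add: \<rho>_def \<sigma>_def flip: diff_divide_distrib)
  then have "\<rho> \<noteq> \<sigma>" using D assms by auto
  \<comment> \<open>The weights solve the equations for the coefficients of x_1 x_2 and x_2^2. The
    one for x_1^2 then follows from orthogonality and \<open>roots\<close>.\<close>
  define \<alpha> \<beta> where "\<alpha> i = (y i - 2 * \<sigma> * z i) / (2 * (\<rho> - \<sigma>))" and "\<beta> i = z i - \<alpha> i" for i
  have z: "\<alpha> i + \<beta> i = z i" for i by (simp add: \<beta>_def)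
  have y: "2 * \<alpha> i * \<rho> + 2 * \<beta> i * \<sigma> = y i" for i
  proof -
    have "\<alpha> i * (2 * (\<rho> - \<sigma>)) = y i - 2 * \<sigma> * z i"
      using \<open>\<rho> \<noteq> \<sigma>\<close> by (simp add: \<alpha>_def)
    then show ?thesis by (simp add: \<beta>_def algebra_simps)
  qed
  have x: "\<alpha> i * \<rho>\<^sup>2 + \<beta> i * \<sigma>\<^sup>2 = x i" if "i < d" for i
  proof -
    have "a * (\<alpha> i * \<rho>\<^sup>2 + \<beta> i * \<sigma>\<^sup>2) = \<alpha> i * (a * \<rho>\<^sup>2) + \<beta> i * (a * \<sigma>\<^sup>2)"
      by (simp add: algebra_simps)
    also have "a * \<rho>\<^sup>2 = - 2 * b * \<rho> - c" using roots by linarith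
    also have "a * \<sigma>\<^sup>2 = - 2 * b * \<sigma> - c" using roots by linarith
    also have "\<alpha> i * (- 2 * b * \<rho> - c) + \<beta> i * (- 2 * b * \<sigma> - c)
        = - b * (2 * \<alpha> i * \<rho> + 2 * \<beta> i * \<sigma>) - c * (\<alpha> i + \<beta> i)"
      by (simp add: algebra_simps)
    also have "\<dots> = a * x i" using orth[OF that] unfolding y z by linarith
    finally show ?thesis using assms(1) by simp
  qed
  \<comment> \<open>The hidden neurons compute \<open>\<rho>\<close> x_1 + x_2 and
    \<open>\<sigma>\<close> x_1 + x_2.\<close>
  define W\<^sub>1 W\<^sub>2
    where "W\<^sub>1 = mat 2 2 (\<lambda>(i, j). if j = 0 then if i = 0 then \<rho> else \<sigma> else (1::real))"
      and "W\<^sub>2 = mat d 2 (\<lambda>(i, j). if j = 0 then \<alpha> i else \<beta> i)"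
  have carrier: "W\<^sub>1 \<in> carrier_mat 2 2" "W\<^sub>2 \<in> carrier_mat d 2" by (simp_all add: W\<^sub>1_def W\<^sub>2_def)
  have "param_map [2, 2, d] 2 [W\<^sub>1, W\<^sub>2] = vec d (\<lambda>i. quadratic_form (x i) (y i) (z i))"
    unfolding param_map_2_2[OF carrier]
    by (intro eq_vecI) (simp_all add: W\<^sub>1_def W\<^sub>2_def x y z)
  moreover have "[W\<^sub>1, W\<^sub>2] \<in> weights [2, 2, d]"
    using carrier by (auto simp: weights_def less_Suc_eq)
  ultimately show ?thesis unfolding neuromanifold_def by (intro image_eqI) simp_all
qed

text \<open>Substituting polynomials in \<open>t\<close> for the variables of \<open>P\<close> gives
  a polynomial in \<open>t\<close>, so that roots can be counted in one variable.\<close>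

lemma mpoly_eval_along_curve:
  fixes c :: "'v \<Rightarrow> real poly"
  shows "\<exists>Q. \<forall>t. mpoly_eval (\<lambda>v. poly (c v) t) P = poly Q t"
proof
  show "\<forall>t. mpoly_eval (\<lambda>v. poly (c v) t) P = poly (\<Sum>m\<in>Poly_Mapping.keys P.
    smult (Poly_Mapping.lookup P m) (monomial_eval c m)) t"
    by (simp add: mpoly_eval_def monomial_eval_def poly_sum poly_prod)
qed

text \<open>\<open>F\<close> itself may lie outside the neuromanifold: the pair x_1^2 - x_2^2, x_1
  x_2 spans no square of a nonzero real linear form. Hence the passage to a line through
  \<open>F\<close>.\<close>

lemma vanishes_on_closure:
  assumes F: "F \<in> Sym_tuples 2 2 d"
    and rows: "\<And>i j k. i < d \<Longrightarrow> j < d \<Longrightarrow> k < d \<Longrightarrow> row_det3 (coeff_mat F) i j k = 0"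
    and P: "\<And>G. G \<in> neuromanifold [2, 2, d] 2 \<Longrightarrow> mpoly_eval (coord G) P = 0"
  shows "mpoly_eval (coord F) P = 0"
proof -
  have dim: "dim_vec F = d" using F by (auto simp: Sym_tuples_def)
  let ?l = "\<lambda>i j. Poly_Mapping.lookup (F $ i) (binary_quadratic_monomials ! j)"
  define x y z where "x i = ?l i 0" and "y i = ?l i 1" and "z i = ?l i 2" for i
  have F_eq: "F $ i = quadratic_form (x i) (y i) (z i)" if "i < d" for i
    using F that Sym_2_2_eq_quadratic_form[of "F $ i"] by (simp add: Sym_tuples_def x_def y_def z_def)
  obtain a b c where abc: "(a, b, c) \<noteq> (0, 0, 0)" "\<And>i. i < d \<Longrightarrow> a * x i + b * y i + c * z i = 0"
    using kernel_vector3[of d x y z] rows dim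
    by (auto simp: row_det3_def coeff_mat_def x_def y_def z_def simp del: One_nat_def)
  \<comment> \<open>Row \<open>i\<close> will move in direction \<open>(p, q, p)\<close>.
    Orthogonality to \<open>(a + t, b, c - t)\<close> gives this equation in degree 1 in
    \<open>t\<close>; the equal outer entries cancel degree 2.\<close>
  have "\<exists>p q. (a + c) * p + b * q = z i - x i" if "i < d" for i
  proof (cases "b = 0 \<and> a + c = 0")
    case True
    \<comment> \<open>The left side of the equation is 0 here, but orthogonality to
      \<open>(a, 0, - a)\<close> forces \<open>x i = z i\<close>.\<close>
    then have c: "c = - a" and "a \<noteq> 0" using abc(1) by auto
    then have "a * (x i - z i) = 0"
      using abc(2)[OF that] True unfolding c by (simp add: right_diff_distrib)
    then show ?thesis using \<open>a \<noteq> 0\<close> by (intro exI[of _ 0]) simp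
  next
    case False
    show ?thesis
    proof (cases "b = 0")
      case True
      then show ?thesis using False by (intro exI[of _ "(z i - x i) / (a + c)"]) simp
    next
      case False
      then show ?thesis by (intro exI[of _ 0] exI[of _ "(z i - x i) / b"]) simp
    qed
  qed
  then obtain p q where pq: "\<And>i. i < d \<Longrightarrow> (a + c) * p i + b * q i = z i - x i" by metis
  define G where "G t = vec d (\<lambda>i. quadratic_form (x i + t * p i) (y i + t * q i) (z i + t * p i))" for t
  \<comment> \<open>The coordinates of \<open>G t\<close> as polynomials in \<open>t\<close> of
    degree at most 1, with those of \<open>F\<close> as constant terms; out-of-range indices give 0,
    as in \<open>coord\<close>.\<close>
  define u where "u = (\<lambda>(i, m). if i < d then [:Poly_Mapping.lookup (F $ i) m,
    Poly_Mapping.lookup (quadratic_form (p i) (q i) (p i)) m:] else 0)"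
  have coord_G: "coord (G t) = (\<lambda>v. poly (u v) t)" for t
    by (auto simp: fun_eq_iff coord_def G_def u_def F_eq lookup_quadratic_form)
  obtain Q where Q: "\<And>t. mpoly_eval (\<lambda>v. poly (u v) t) P = poly Q t"
    using mpoly_eval_along_curve by blast
  \<comment> \<open>The bound makes \<open>a + t\<close> positive and \<open>c - t\<close>
    negative.\<close>
  have "poly Q t = 0" if "t > max (- a) c" for t
  proof -
    have "(a + t) * (x i + t * p i) + b * (y i + t * q i) + (c - t) * (z i + t * p i) = 0"
      if "i < d" for i
    proof -
      have "(a + t) * (x i + t * p i) + b * (y i + t * q i) + (c - t) * (z i + t * p i)
          = (a * x i + b * y i + c * z i) + t * ((a + c) * p i + b * q i - (z i - x i))"
        by (simp add: algebra_simps)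
      then show ?thesis using abc(2) pq that by simp
    qed
    then have "G t \<in> neuromanifold [2, 2, d] 2"
      unfolding G_def using that
      by (intro orthogonal_to_indefinite_in_neuromanifold[of "a + t" "c - t" _ _ b]) auto
    then show ?thesis using P coord_G Q by metis
  qed
  then have "{max (- a) c<..} \<subseteq> {t. poly Q t = 0}" by blast
  then have "infinite {t. poly Q t = 0}" using infinite_Ioi infinite_super by blast
  then have "Q = 0" using poly_roots_finite by blast
  moreover have "coord F = (\<lambda>v. poly (u v) 0)"
    by (auto simp: fun_eq_iff coord_def u_def dim)
  ultimately show ?thesis using Q by simp
qed

theorem proposition4p1:
  fixes d\<^sub>2 :: nat
  assumes "d\<^sub>2 > 0"
  shows "neurovariety [2, 2, d\<^sub>2] 2 =
    {F \<in> Sym_tuples 2 2 d\<^sub>2. \<forall>\<mu> \<in> minors 3 (coeff_mat F). \<mu> = 0}"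
proof -
  let ?S = "Sym_tuples 2 2 d\<^sub>2" and ?M = "neuromanifold [2, 2, d\<^sub>2] 2"
  \<comment> \<open>Both inclusions work with row triples; the minors return only at the
    end.\<close>
  let ?X = "{F \<in> ?S. \<forall>i<d\<^sub>2. \<forall>j<d\<^sub>2. \<forall>k<d\<^sub>2. row_det3 (coeff_mat F) i j k = 0}"
  have ambient: "ambient [2, 2, d\<^sub>2] 2 = ?S" by (simp add: ambient_def)
  have "?M \<subseteq> ?S"
    using param_map_in_Sym_tuples[of _ "[2, 2, d\<^sub>2]" 2] by (auto simp: neuromanifold_def)
  then have "?M \<subseteq> ?X" using neuromanifold_row_det3 by blast
  then have "zariski_closed ?S hull ?M \<subseteq> ?X"
    by (intro hull_minimal zariski_closed_row_det3)
  moreover have "?X \<subseteq> zariski_closed ?S hull ?M"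
    \<comment> \<open>The hull is an intersection, so \<open>F\<close> is tested against each closed
      \<open>V\<close> containing \<open>?M\<close>, one equation at a time.\<close>
    unfolding hull_def
  proof (intro Inter_greatest subsetI)
    fix V F assume "V \<in> {V. zariski_closed ?S V \<and> ?M \<subseteq> V}" and F: "F \<in> ?X"
    then obtain Ps where V: "V = {F \<in> ?S. \<forall>P\<in>Ps. mpoly_eval (coord F) P = 0}" and "?M \<subseteq> V"
      unfolding zariski_closed_def by blast
    then have "mpoly_eval (coord F) P = 0" if "P \<in> Ps" for P
      using that F by (intro vanishes_on_closure[of F d\<^sub>2]) auto
    then show "F \<in> V" using F V by blast
  qed
  moreover have "?X = {F \<in> ?S. \<forall>\<mu> \<in> minors 3 (coeff_mat F). \<mu> = 0}"
    using minors_3_vanish_iff[OF coeff_mat_carrier[of _ d\<^sub>2]] by (auto simp: Sym_tuples_def)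
  ultimately show ?thesis by (simp add: neurovariety_def ambient)
qed

end
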